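(* Let $G=(V,E)$ be a bipartite $(2,2)$-Laman graph with minimum degree three. Then for every vertex $v$ of degree three, there exist two neighbors $x,y$ of $v$ and a vertex $p$ that is adjacent to $y$ and not adjacent to $x$, such that the graph $G'=(G-v)\cup xp$ (obtained from $G-v$ by adding the edge $xp$) is $(2,2)$-Laman.
   Context: All graphs are finite and simple. $G-v$ denotes the induced subgraph on $V\setminus\{v\}$. A bipartite graph $G=(A\uplus B,E)$ (with a fixed bipartition into parts $A$, $B$) with $|A|\ge 2$ and $|B|\ge 2$ is called $(2,2)$-Laman if (i) $G$ has exactly $2(|A|+|B|)-4$ edges, and (ii) every subgraph $H$ of $G$ with at least $3$ vertices has at most $2|V(H)|-4$ edges. *)

theory Defs
  imports Main
begin

record 'a ugraph =
  verts :: "'a set"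
  edges :: "'a set set"

definition simple_graph :: "'a ugraph \<Rightarrow> bool" where
  "simple_graph G \<longleftrightarrow> finite (verts G) \<and> (\<forall>e\<in>edges G. e \<subseteq> verts G \<and> card e = 2)"

definition adjacent :: "'a ugraph \<Rightarrow> 'a \<Rightarrow> 'a \<Rightarrow> bool" where
  "adjacent G u w \<longleftrightarrow> {u, w} \<in> edges G"

definition degree :: "'a ugraph \<Rightarrow> 'a \<Rightarrow> nat" where
  "degree G v = card {w \<in> verts G. adjacent G v w}"

(* Only meaningful for graphs with a finite, nonempty vertex set. *)
definition min_degree :: "'a ugraph \<Rightarrow> nat" where
  "min_degree G = Min (degree G ` verts G)"

(* Not necessarily induced, and not necessarily spanning. *)
definition subgraph :: "'a ugraph \<Rightarrow> 'a ugraph \<Rightarrow> bool" where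
  "subgraph H G \<longleftrightarrow> simple_graph H \<and> verts H \<subseteq> verts G \<and> edges H \<subseteq> edges G"

definition delete_vertex :: "'a ugraph \<Rightarrow> 'a \<Rightarrow> 'a ugraph" where
  "delete_vertex G v = \<lparr>verts = verts G - {v}, edges = {e \<in> edges G. v \<notin> e}\<rparr>"

definition add_edge :: "'a ugraph \<Rightarrow> 'a \<Rightarrow> 'a \<Rightarrow> 'a ugraph" where
  "add_edge G u w = \<lparr>verts = verts G, edges = insert {u, w} (edges G)\<rparr>"

definition bipartite_graph :: "'a ugraph \<Rightarrow> 'a set \<Rightarrow> 'a set \<Rightarrow> bool" where
  "bipartite_graph G A B \<longleftrightarrow>
     simple_graph G \<and> verts G = A \<union> B \<and> A \<inter> B = {} \<and>
     (\<forall>e\<in>edges G. \<exists>a\<in>A. \<exists>b\<in>B. e = {a, b})"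

(* The subtractions on nat never truncate, by the cardinality conditions. *)
definition laman22 :: "'a ugraph \<Rightarrow> 'a set \<Rightarrow> 'a set \<Rightarrow> bool" where
  "laman22 G A B \<longleftrightarrow>
     bipartite_graph G A B \<and> card A \<ge> 2 \<and> card B \<ge> 2 \<and>
     card (edges G) = 2 * (card A + card B) - 4 \<and>
     (\<forall>H. subgraph H G \<and> card (verts H) \<ge> 3 \<longrightarrow>
          card (edges H) \<le> 2 * card (verts H) - 4)"

end

theory Submission imports Defs begin

text \<open>
  Work in G - v and call a set W of at least three vertices tight if it spans exactly 2|W| - 4 edges.
  If the new edge xp is never admissible, then for any two neighbors x, y of v and every vertex p
  adjacent to y but not to x, some tight set contains x and p.  The defect 2|W| - 4 - i(W), where
  i(W) is the number of edges spanned by W, is submodular, and it follows that in fact every edge xp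
  lies in a tight set together with y.  Tight sets sharing two nonadjacent vertices or at least three
  vertices have a tight union.  Since x has two neighbors in G - v, these tight sets merge into one
  containing all three neighbors of v; adding v to it gives a subgraph of G with too many edges.
\<close>

section \<open>Sparse bipartite edge sets and the defect of a vertex set\<close>

text \<open>Models the graph left after deleting the degree-three vertex. Quantifying over vertex
  sets suffices, since an induced subgraph has the most edges on its vertices; the bound is over the
  integers to avoid truncated subtraction.\<close>

locale sparse_bipartite =
  fixes A B :: "'a set" and E :: "'a set set"
  assumes fin: "finite (A \<union> B)"
    and disj: "A \<inter> B = {}"
    and edge: "e \<in> E \<Longrightarrow> \<exists>a\<in>A. \<exists>b\<in>B. e = {a, b}"
    and sparse: "W \<subseteq> A \<union> B \<Longrightarrow> 3 \<le> card W \<Longrightarrow> int (card {e \<in> E. e \<subseteq> W}) \<le> 2 * int (card W) - 4"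
begin

definition adj :: "'a \<Rightarrow> 'a \<Rightarrow> bool" where
  "adj u w \<longleftrightarrow> {u, w} \<in> E"

text \<open>Integer-valued because small sets matter: a single vertex has defect -2, an edge -1 and
  a nonadjacent pair 0.\<close>

definition defect :: "'a set \<Rightarrow> int" where
  "defect W = 2 * int (card W) - 4 - int (card {e \<in> E. e \<subseteq> W})"

definition tight :: "'a set \<Rightarrow> bool" where
  "tight W \<longleftrightarrow> W \<subseteq> A \<union> B \<and> 3 \<le> card W \<and> defect W = 0"

text \<open>A tight set through \<open>x\<close> and \<open>p\<close> is exactly what adding the
  edge \<open>xp\<close> would overfill; \<open>y\<close> enters only through the choice of
  \<open>p\<close>. The relation is not symmetric, so later lemmas assume it in both
  directions.\<close>

definition blocked :: "'a \<Rightarrow> 'a \<Rightarrow> bool" where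
  "blocked x y \<longleftrightarrow> (\<forall>p. adj y p \<and> \<not> adj x p \<longrightarrow> (\<exists>T. tight T \<and> x \<in> T \<and> p \<in> T))"

lemma adj_sym: "adj u w \<Longrightarrow> adj w u"
  by (simp add: adj_def insert_commute)

lemma adj_cases: "adj u w \<Longrightarrow> u \<in> A \<and> w \<in> B \<or> u \<in> B \<and> w \<in> A"
  using edge[of "{u, w}"] by (auto simp: adj_def doubleton_eq_iff)

lemma adj_irrefl: "\<not> adj u u"
  using adj_cases[of u u] disj by auto

lemma adj_A: "u \<in> B \<Longrightarrow> adj u w \<Longrightarrow> w \<in> A"
  using adj_cases disj by blast

lemma finite_sub: "W \<subseteq> A \<union> B \<Longrightarrow> finite W"
  using fin finite_subset by blast

lemma finite_edges: "W \<subseteq> A \<union> B \<Longrightarrow> finite {e \<in> E. e \<subseteq> W}"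
  by (rule finite_subset[of _ "Pow W"]) (auto simp: finite_sub)

lemma defect_nonneg: "W \<subseteq> A \<union> B \<Longrightarrow> 3 \<le> card W \<Longrightarrow> 0 \<le> defect W"
  using sparse[of W] by (simp add: defect_def)

text \<open>Below three vertices only the pair itself remains, and it spans no edge. This allows
  uncrossing of tight sets that meet in just two vertices.\<close>

lemma defect_nonneg_pair:
  assumes W: "W \<subseteq> A \<union> B" and uw: "u \<in> W" "w \<in> W" "u \<noteq> w" "\<not> adj u w"
  shows "0 \<le> defect W"
proof (cases "3 \<le> card W")
  case True
  then show ?thesis using defect_nonneg W by blast
next
  case False
  have "card {u, w} = 2" using uw by simp
  moreover have "{u, w} \<subseteq> W" using uw by auto
  ultimately have "W = {u, w}"
    using False finite_sub[OF W] by (intro card_seteq[symmetric]) auto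
  have "{e \<in> E. e \<subseteq> W} = {}"
  proof -
    have False if e: "e \<in> E" "e \<subseteq> {u, w}" for e
    proof -
      obtain a b where "a \<in> A" "b \<in> B" "e = {a, b}" using edge e by blast
      moreover have "a \<noteq> b" using calculation disj by auto
      ultimately have "e = {u, w}" using e by auto
      then show False using e uw by (simp add: adj_def)
    qed
    then show ?thesis using \<open>W = {u, w}\<close> by auto
  qed
  then show ?thesis using \<open>W = {u, w}\<close> uw by (simp add: defect_def)
qed

text \<open>Vertex counts are modular, so the only discrepancy comes from edges inside the union but
  inside neither set. The exact identity is kept because the equality case later rules out such
  edges.\<close>

lemma defect_submodular:
  assumes "X \<subseteq> A \<union> B" "Y \<subseteq> A \<union> B"
  shows "defect (X \<union> Y) + defect (X \<inter> Y)
    + int (card {e \<in> E. e \<subseteq> X \<union> Y \<and> \<not> e \<subseteq> X \<and> \<not> e \<subseteq> Y}) = defect X + defect Y"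
proof -
  let ?i = "\<lambda>W. {e \<in> E. e \<subseteq> W}"
  let ?c = "{e \<in> E. e \<subseteq> X \<union> Y \<and> \<not> e \<subseteq> X \<and> \<not> e \<subseteq> Y}"
  have XY: "X \<union> Y \<subseteq> A \<union> B" using assms by auto
  have fc: "finite ?c" by (rule finite_subset[OF _ finite_edges[OF XY]]) auto
  have "?i (X \<union> Y) = (?i X \<union> ?i Y) \<union> ?c" by auto
  then have "card (?i (X \<union> Y)) = card (?i X \<union> ?i Y) + card ?c"
    using finite_edges assms fc by (simp only:) (rule card_Un_disjoint; auto)
  moreover have "card (?i X) + card (?i Y) = card (?i X \<union> ?i Y) + card (?i (X \<inter> Y))"
  proof -
    have "?i X \<inter> ?i Y = ?i (X \<inter> Y)" by auto
    then show ?thesis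
      using card_Un_Int[OF finite_edges[OF assms(1)] finite_edges[OF assms(2)]] by simp
  qed
  moreover have "card X + card Y = card (X \<union> Y) + card (X \<inter> Y)"
    using card_Un_Int finite_sub assms by blast
  ultimately show ?thesis by (simp add: defect_def)
qed

lemma defect_submodular_le:
  assumes "X \<subseteq> A \<union> B" "Y \<subseteq> A \<union> B"
  shows "defect (X \<union> Y) + defect (X \<inter> Y) \<le> defect X + defect Y"
  using defect_submodular[OF assms] by linarith

lemma defect_insert:
  assumes W: "W \<subseteq> A \<union> B" and "u \<notin> W"
  shows "defect (insert u W) = defect W + 2 - int (card {w \<in> W. adj u w})"
proof -
  let ?N = "(\<lambda>w. {u, w}) ` {w \<in> W. adj u w}"
  have "{e \<in> E. e \<subseteq> insert u W} = {e \<in> E. e \<subseteq> W} \<union> ?N"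
  proof (intro set_eqI iffI)
    fix e assume "e \<in> {e \<in> E. e \<subseteq> insert u W}"
    then have e: "e \<in> E" "e \<subseteq> insert u W" by auto
    then obtain a b where ab: "a \<in> A" "b \<in> B" "e = {a, b}" using edge by blast
    have "a \<noteq> b" using ab disj by auto
    then show "e \<in> {e \<in> E. e \<subseteq> W} \<union> ?N"
      using e ab by (auto simp: adj_def insert_commute)
  qed (auto simp: adj_def)
  moreover have "{e \<in> E. e \<subseteq> W} \<inter> ?N = {}" using assms by auto
  moreover have "inj_on (\<lambda>w. {u, w}) {w \<in> W. adj u w}"
    by (auto simp: inj_on_def doubleton_eq_iff)
  ultimately have "card {e \<in> E. e \<subseteq> insert u W} = card {e \<in> E. e \<subseteq> W} + card {w \<in> W. adj u w}"
    using finite_edges[OF W] finite_sub[OF W] by (simp add: card_Un_disjoint card_image)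
  then show ?thesis using finite_sub[OF W] assms by (simp add: defect_def)
qed

section \<open>Unions of tight sets and degrees inside them\<close>

lemma tight_Un:
  assumes "tight X" "tight Y" "0 \<le> defect (X \<inter> Y)"
  shows "tight (X \<union> Y)"
proof -
  have sub: "X \<subseteq> A \<union> B" "Y \<subseteq> A \<union> B" using assms by (auto simp: tight_def)
  have "card X \<le> card (X \<union> Y)" using sub by (simp add: card_mono finite_sub)
  then have "3 \<le> card (X \<union> Y)" using assms by (simp add: tight_def)
  moreover have "defect (X \<union> Y) \<le> 0"
    using defect_submodular_le[OF sub] assms by (simp add: tight_def)
  ultimately show ?thesis using sub defect_nonneg[of "X \<union> Y"] by (simp add: tight_def)
qed

text \<open>Removing \<open>u\<close> changes the defect by its degree in \<open>Z\<close> minus 2,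
  so the claim follows if the rest has nonnegative defect. Otherwise the rest is a single edge
  \<open>wt\<close>; as \<open>nc\<close> forbids \<open>u\<close> from being adjacent to
  \<open>t\<close>, \<open>Z\<close> would have defect 1.\<close>

lemma tight_degree:
  assumes Z: "tight Z" and uw: "u \<in> Z" "w \<in> Z" "u \<noteq> w" "\<not> adj u w"
    and nc: "\<And>t. adj u t \<Longrightarrow> \<not> adj w t"
  shows "2 \<le> card {t \<in> Z. adj u t}"
proof -
  let ?Y = "Z - {u}"
  have sub: "Z \<subseteq> A \<union> B" and c: "3 \<le> card Z" and d0: "defect Z = 0"
    using Z by (auto simp: tight_def)
  have fZ: "finite Z" using finite_sub sub by blast
  have Y: "?Y \<subseteq> A \<union> B" using sub by auto
  have ins: "insert u ?Y = Z" using uw by auto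
  have deg: "{t \<in> ?Y. adj u t} = {t \<in> Z. adj u t}" using adj_irrefl by auto
  have d: "0 = defect ?Y + 2 - int (card {t \<in> Z. adj u t})"
    using defect_insert[OF Y, of u] ins deg d0 by simp
  show ?thesis
  proof (cases "3 \<le> card ?Y")
    case True
    then show ?thesis using d defect_nonneg[OF Y] by linarith
  next
    case False
    then have "card ?Y = 2" using c fZ uw by simp
    then have "card (?Y - {w}) = 1" using uw fZ by simp
    then obtain t where "?Y - {w} = {t}" by (auto simp: card_1_singleton_iff)
    then have t: "?Y = {w, t}" "t \<noteq> w" using uw by auto
    show ?thesis
    proof (cases "adj w t")
      case True
      then have "\<not> adj u t" using nc by blast
      have "defect {t} = -2"
      proof -
        have "{e \<in> E. e \<subseteq> {t}} = {}"
          using edge disj by fastforce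
        then show ?thesis by (simp add: defect_def)
      qed
      moreover have "{t} \<subseteq> A \<union> B" using t Y by auto
      moreover have "{s. s = t \<and> adj w s} = {t}" using True by auto
      ultimately have "defect {w, t} = -1"
        using defect_insert[of "{t}" w] t by simp
      moreover have "{s \<in> ?Y. adj u s} = {}"
        unfolding t(1) using \<open>\<not> adj u t\<close> uw by auto
      then have "card {s \<in> Z. adj u s} = 0" unfolding deg by (simp only: card.empty)
      ultimately show ?thesis using d unfolding t(1) by linarith
    next
      case False
      have "0 \<le> defect ?Y" using defect_nonneg_pair[OF Y, of w t] t False by auto
      then show ?thesis using d by linarith
    qed
  qed
qed

text \<open>Vertices in opposite parts have no common neighbor, which rules out the path on three
  vertices, where an end has degree only 1.\<close>

lemma tight_degree_opposite:
  assumes "tight Z" "u \<in> Z" "w \<in> Z" "\<not> adj u w" "u \<in> A \<and> w \<in> B \<or> u \<in> B \<and> w \<in> A"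
  shows "2 \<le> card {t \<in> Z. adj u t}"
  using assms(5)
proof (intro tight_degree[OF assms(1-3) _ assms(4)])
  show "u \<noteq> w" using assms(5) disj by auto
  show "\<not> adj w t" if "adj u t" for t
    using assms(5) adj_cases[of u t] adj_cases[of w t] that disj by auto
qed

text \<open>A path on three vertices has two edges, which is exactly 2 * 3 - 4.\<close>

lemma tight_common_nbr:
  assumes "adj p x" "adj p y" "x \<noteq> y"
  shows "tight {x, p, y}"
proof -
  have xy: "{x, y} \<subseteq> A \<union> B" "\<not> adj x y" "p \<noteq> x" "p \<noteq> y" "p \<in> A \<union> B"
    using adj_cases[of p x] adj_cases[of p y] adj_cases[of x y] assms disj by auto
  have "0 \<le> defect {x, y}" using defect_nonneg_pair[OF xy(1), of x y] assms xy by auto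
  then have "defect {x, y} = 0" using assms by (simp add: defect_def)
  moreover have "{w \<in> {x, y}. adj p w} = {x, y}" using assms by auto
  ultimately have "defect (insert p {x, y}) = 0"
    using defect_insert[OF xy(1), of p] xy assms by simp
  moreover have "insert p {x, y} = {x, p, y}" by auto
  ultimately show ?thesis using xy assms by (auto simp: tight_def)
qed

section \<open>Merging tight sets when every candidate edge is blocked\<close>

text \<open>
  By induction on the size of the complement of U.  If U contains no tight set through x and p, then a
  tight set R through x and p meets U in these two vertices only, and U \<union> R again has defect 1.
  Now x has a neighbor r in R outside U, and the claim for U \<union> R with x and y exchanged gives
  a tight set Z through y and r.  All neighbors of r in Z lie in R, so Z \<union> R is tight, and
  it cuts U in a tight set through x and p.
\<close>
lemma blocked_inside:
  assumes "blocked x y" "blocked y x" and "x \<in> B" "y \<in> B" "x \<noteq> y"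
    and "U \<subseteq> A \<union> B" "x \<in> U" "y \<in> U" "defect U = 1"
    and "\<And>T. tight T \<Longrightarrow> \<not> U \<subseteq> T"
    and "p \<in> U" "adj y p" "\<not> adj x p"
  shows "\<exists>T\<subseteq>U. tight T \<and> x \<in> T \<and> p \<in> T"
  using assms
proof (induction "card (A \<union> B) - card U" arbitrary: U x y p rule: less_induct)
  case less
  note U = \<open>U \<subseteq> A \<union> B\<close> and nt = \<open>\<And>T. tight T \<Longrightarrow> \<not> U \<subseteq> T\<close>
  have pA: "p \<in> A" using adj_A less.prems by blast
  have px: "p \<noteq> x" "p \<noteq> y" using pA less.prems disj by auto
  have "3 \<le> card U"
  proof -
    have "{x, y, p} \<subseteq> U" "card {x, y, p} = 3" using less.prems px by auto
    then show ?thesis by (metis card_mono finite_sub[OF U])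
  qed
  have big: "1 \<le> defect W" if "U \<subseteq> W" "W \<subseteq> A \<union> B" for W
  proof -
    have "3 \<le> card W" using that \<open>3 \<le> card U\<close> card_mono[OF finite_sub] order_trans by blast
    then have "0 \<le> defect W" "defect W \<noteq> 0"
      using nt[of W] that defect_nonneg[of W] by (auto simp: tight_def)
    then show ?thesis by linarith
  qed
  \<comment> \<open>The defects of \<open>W\<close> and \<open>U\<close> sum to 1, and by
    \<open>big\<close> the union already takes at least 1, so nothing is left for the
    intersection.\<close>
  have cap: "tight (W \<inter> U)" if W: "tight W" "3 \<le> card (W \<inter> U)" for W
  proof -
    have "W \<subseteq> A \<union> B" using W by (simp add: tight_def)
    moreover have "1 \<le> defect (W \<union> U)" using big U calculation by auto
    ultimately have "defect (W \<inter> U) \<le> 0"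
      using defect_submodular_le[of W U] U W less.prems by (simp add: tight_def)
    then show ?thesis using W U defect_nonneg[of "W \<inter> U"] by (auto simp: tight_def)
  qed
  show ?case
  proof (rule ccontr)
    assume neg: "\<not> ?case"
    obtain R where R: "tight R" "x \<in> R" "p \<in> R"
      using \<open>blocked x y\<close> less.prems by (auto simp: blocked_def)
    have RV: "R \<subseteq> A \<union> B" using R by (simp add: tight_def)
    have RU: "R \<inter> U = {x, p}"
    proof -
      have "{x, p} \<subseteq> R \<inter> U" "card {x, p} = 2" using R less.prems px by auto
      moreover have "\<not> 3 \<le> card (R \<inter> U)" using neg cap[OF R(1)] R less.prems by blast
      ultimately show ?thesis
        using finite_sub[OF RV] by (intro card_seteq[symmetric]) auto
    qed
    have d0: "0 \<le> defect (R \<inter> U)"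
      using defect_nonneg_pair[of "R \<inter> U" x p] RV R less.prems px by auto
    \<comment> \<open>The three terms of the submodular identity sum to 1 and the union alone
      accounts for 1; hence no edge joins \<open>R - U\<close> to \<open>U - R\<close>.\<close>
    let ?C = "{e \<in> E. e \<subseteq> R \<union> U \<and> \<not> e \<subseteq> R \<and> \<not> e \<subseteq> U}"
    have "1 \<le> defect (R \<union> U)" using big RV U by auto
    moreover have "defect (R \<union> U) + defect (R \<inter> U) + int (card ?C) = 1"
      using defect_submodular[OF RV U] R less.prems by (simp add: tight_def)
    ultimately have dRU: "defect (R \<union> U) = 1" and "card ?C = 0" using d0 by auto
    moreover have "finite ?C"
      by (rule finite_subset[OF _ finite_edges[of "R \<union> U"]]) (use RV U in auto)
    ultimately have C: "?C = {}" by simp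
    have nocross: "\<not> adj s t" if "s \<in> R - U" "t \<in> U - R" for s t
    proof
      assume "adj s t"
      then have "{s, t} \<in> ?C" using that by (simp add: adj_def)
      then show False using C by blast
    qed
    have "2 \<le> card {t \<in> R. adj x t}"
      using tight_degree_opposite[OF R] pA less.prems by auto
    then obtain r where r: "r \<in> R" "adj x r"
      by (metis (mono_tags, lifting) card.empty empty_Collect_eq not_numeral_le_zero)
    have rA: "r \<in> A" using adj_A r less.prems by blast
    have "r \<noteq> x" "r \<noteq> p" using r less.prems adj_irrefl by auto
    then have rU: "r \<notin> U" using RU r by blast
    have yR: "y \<notin> R"
    proof
      assume "y \<in> R"
      then have "y \<in> {x, p}" using RU less.prems by blast
      then show False using less.prems px by auto
    qed
    have ry: "\<not> adj y r" using nocross[of r y] r rU yR less.prems adj_sym by blast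
    have "card U < card (R \<union> U)"
      using r rU finite_sub[of "R \<union> U"] RV U by (intro psubset_card_mono) auto
    moreover have "card (R \<union> U) \<le> card (A \<union> B)"
      using RV U fin by (intro card_mono) auto
    ultimately have "card (A \<union> B) - card (R \<union> U) < card (A \<union> B) - card U" by linarith
    then have "\<exists>T\<subseteq>R \<union> U. tight T \<and> y \<in> T \<and> r \<in> T"
      by (rule less.hyps[of "R \<union> U" y x r]) (use less.prems RV dRU r ry in auto)
    then obtain Z where Z: "Z \<subseteq> R \<union> U" "tight Z" "y \<in> Z" "r \<in> Z" by blast
    have ZV: "Z \<subseteq> A \<union> B" using Z by (simp add: tight_def)
    have "2 \<le> card {t \<in> Z. adj r t}"
      using tight_degree_opposite[of Z r y] Z ry adj_sym rA less.prems by blast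
    \<comment> \<open>The vertex \<open>r\<close> and its at least two neighbors in \<open>Z\<close>
      give three vertices common to \<open>Z\<close> and \<open>R\<close>.\<close>
    moreover have "card (insert r {t \<in> Z. adj r t}) = Suc (card {t \<in> Z. adj r t})"
      using finite_sub[OF ZV] adj_irrefl by (intro card_insert_disjoint) auto
    moreover have "insert r {t \<in> Z. adj r t} \<subseteq> Z \<inter> R"
      using Z r rU nocross[of r] by auto
    then have "card (insert r {t \<in> Z. adj r t}) \<le> card (Z \<inter> R)"
      using finite_sub[OF ZV] by (intro card_mono) auto
    ultimately have "3 \<le> card (Z \<inter> R)" by linarith
    then have W: "tight (Z \<union> R)"
      using tight_Un[OF Z(2) R(1)] defect_nonneg[of "Z \<inter> R"] ZV by auto
    have "{x, y, p} \<subseteq> (Z \<union> R) \<inter> U" using Z R less.prems by auto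
    moreover have "card {x, y, p} = 3" using less.prems px by auto
    ultimately have "3 \<le> card ((Z \<union> R) \<inter> U)"
      by (metis card_mono finite_Int finite_sub[OF U])
    then show False using cap[OF W] neg R less.prems by blast
  qed
qed

text \<open>If \<open>y\<close> is not adjacent to \<open>p\<close>, take a tight \<open>S\<close>
  through \<open>y\<close> and \<open>p\<close>. Should no tight set contain all three vertices,
  adding \<open>x\<close> to \<open>S\<close> gives a set of defect 1 to which
  \<open>blocked_inside\<close> applies; the tight set it yields would need two neighbors of
  \<open>x\<close> in \<open>S\<close>, which has only one.\<close>

lemma blocked_tight:
  assumes bl: "blocked x y" "blocked y x" and xy: "x \<in> B" "y \<in> B" "x \<noteq> y" and p: "adj x p"
  shows "\<exists>T. tight T \<and> x \<in> T \<and> y \<in> T \<and> p \<in> T"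
proof (cases "adj y p")
  case True
  then show ?thesis using tight_common_nbr[of p x y] p xy adj_sym by blast
next
  case False
  have pA: "p \<in> A" using adj_A p xy by blast
  obtain S where S: "tight S" "y \<in> S" "p \<in> S"
    using bl p False by (auto simp: blocked_def)
  have SV: "S \<subseteq> A \<union> B" using S by (simp add: tight_def)
  show ?thesis
  proof (rule ccontr)
    assume neg: "\<not> ?thesis"
    then have xS: "x \<notin> S" using S by blast
    let ?U = "insert x S"
    have UV: "?U \<subseteq> A \<union> B" using SV xy by auto
    have nt: "\<not> ?U \<subseteq> T" if "tight T" for T using neg that S by blast
    have "card S \<le> card ?U" using finite_sub[OF SV] by (simp add: card_insert_le)
    then have "3 \<le> card ?U" using S by (simp add: tight_def)
    then have "0 \<le> defect ?U" "defect ?U \<noteq> 0"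
      using defect_nonneg[OF UV] nt[of ?U] UV by (auto simp: tight_def)
    moreover have dU: "defect ?U = 2 - int (card {w \<in> S. adj x w})"
      using defect_insert[OF SV xS] S by (simp add: tight_def)
    moreover have fN: "finite {w \<in> S. adj x w}" using finite_sub[OF SV] by simp
    moreover have "p \<in> {w \<in> S. adj x w}" using S p by simp
    then have "card {w \<in> S. adj x w} \<noteq> 0" using fN by auto
    \<comment> \<open>Positive defect of \<open>?U\<close> leaves at most one neighbor, and
      \<open>p\<close> is one.\<close>
    ultimately have one: "card {w \<in> S. adj x w} = 1" by linarith
    then have dU1: "defect ?U = 1" using dU by simp
    have "2 \<le> card {t \<in> S. adj y t}"
      using tight_degree_opposite[OF S False] xy pA by blast
    then obtain r where r: "r \<in> S" "adj y r"
      by (metis (mono_tags, lifting) card.empty empty_Collect_eq not_numeral_le_zero)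
    have rA: "r \<in> A" using adj_A r xy by blast
    \<comment> \<open>The only neighbor of \<open>x\<close> in \<open>S\<close> is \<open>p\<close>,
      and \<open>r\<close> differs from \<open>p\<close> because \<open>y\<close> is adjacent to
      \<open>r\<close> but not to \<open>p\<close>.\<close>
    have "\<not> adj x r"
    proof
      assume "adj x r"
      then have "{p, r} \<subseteq> {w \<in> S. adj x w}" using S p r by auto
      moreover have "card {p, r} = 2" using r False by (auto simp: card_2_iff)
      ultimately show False using one card_mono[OF fN] by (metis numeral_le_one_iff semiring_norm(69))
    qed
    then obtain Z where Z: "Z \<subseteq> ?U" "tight Z" "x \<in> Z" "r \<in> Z"
      using blocked_inside[OF bl xy UV _ _ dU1 nt, of r] r S by auto
    have "2 \<le> card {t \<in> Z. adj x t}"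
      using tight_degree_opposite[of Z x r] Z rA xy \<open>\<not> adj x r\<close> by blast
    moreover have "{t \<in> Z. adj x t} \<subseteq> {w \<in> S. adj x w}" using Z adj_irrefl by auto
    then have "card {t \<in> Z. adj x t} \<le> card {w \<in> S. adj x w}" by (rule card_mono[OF fN])
    ultimately show False using one by linarith
  qed
qed

text \<open>The tight sets for \<open>p\<close> and for \<open>q\<close> share the nonadjacent pair
  \<open>x\<close>, \<open>y\<close>, so their union is tight.\<close>

lemma blocked_tight_two:
  assumes "blocked x y" "blocked y x" "x \<in> B" "y \<in> B" "x \<noteq> y" "adj x p" "adj x q"
  shows "\<exists>T. tight T \<and> x \<in> T \<and> y \<in> T \<and> p \<in> T \<and> q \<in> T"
proof -
  obtain S T where ST: "tight S" "x \<in> S" "y \<in> S" "p \<in> S" "tight T" "x \<in> T" "y \<in> T" "q \<in> T"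
    using blocked_tight assms by metis
  have "\<not> adj x y" using adj_cases assms disj by blast
  then have "0 \<le> defect (S \<inter> T)"
    using defect_nonneg_pair[of "S \<inter> T" x y] ST assms by (auto simp: tight_def)
  then have "tight (S \<union> T)" using tight_Un ST by blast
  then show ?thesis using ST by blast
qed

text \<open>Two neighbors of \<open>x\<close> are carried along so that the tight sets for
  \<open>y\<close> and for \<open>z\<close> share the three vertices \<open>x\<close>,
  \<open>p\<close>, \<open>q\<close> and can be merged.\<close>

lemma blocked_tight_triple:
  assumes bl: "blocked x y" "blocked y x" "blocked x z" "blocked z x"
    and xyz: "x \<in> B" "y \<in> B" "z \<in> B" "x \<noteq> y" "x \<noteq> z"
    and pq: "adj x p" "adj x q" "p \<noteq> q"
  shows "\<exists>T. tight T \<and> x \<in> T \<and> y \<in> T \<and> z \<in> T"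
proof -
  obtain S where S: "tight S" "x \<in> S" "y \<in> S" "p \<in> S" "q \<in> S"
    using blocked_tight_two[OF bl(1,2) xyz(1,2,4) pq(1,2)] by blast
  obtain T where T: "tight T" "x \<in> T" "z \<in> T" "p \<in> T" "q \<in> T"
    using blocked_tight_two[OF bl(3,4) xyz(1,3,5) pq(1,2)] by blast
  have SV: "S \<inter> T \<subseteq> A \<union> B" using S by (auto simp: tight_def)
  have "x \<noteq> p" "x \<noteq> q" using pq adj_irrefl by auto
  then have "card {x, p, q} = 3" using pq by auto
  moreover have "{x, p, q} \<subseteq> S \<inter> T" using S T by auto
  ultimately have "3 \<le> card (S \<inter> T)" by (metis card_mono finite_sub[OF SV])
  then have "tight (S \<union> T)" using tight_Un S T defect_nonneg[OF SV] by blast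
  then show ?thesis using S T by blast
qed

end

section \<open>Transfer to Laman graphs and the reduction at a degree-three vertex\<close>

lemma bipartite_graph_swap:
  assumes "bipartite_graph G A B"
  shows "bipartite_graph G B A"
proof -
  have "\<exists>b\<in>B. \<exists>a\<in>A. e = {b, a}" if "e \<in> edges G" for e
    using assms that unfolding bipartite_graph_def by (metis insert_commute)
  then show ?thesis using assms by (auto simp: bipartite_graph_def)
qed

lemma laman22_swap:
  assumes "laman22 G A B"
  shows "laman22 G B A"
  using assms bipartite_graph_swap[of G A B] by (simp add: laman22_def add.commute)

lemma laman22_induced:
  assumes "laman22 G A B" "W \<subseteq> verts G" "3 \<le> card W"
  shows "int (card {e \<in> edges G. e \<subseteq> W}) \<le> 2 * int (card W) - 4"
proof -
  let ?H = "\<lparr>verts = W, edges = {e \<in> edges G. e \<subseteq> W}\<rparr>"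
  have "simple_graph G" using assms by (simp add: laman22_def bipartite_graph_def)
  then have "subgraph ?H G"
    using assms(2) finite_subset by (auto simp: subgraph_def simple_graph_def)
  then have "card (edges ?H) \<le> 2 * card (verts ?H) - 4"
    using assms(1,3) unfolding laman22_def by (metis ugraph.select_convs(1))
  then show ?thesis using assms(3) by auto
qed

text \<open>Fixing the side of \<open>v\<close> puts all its neighbors in \<open>B\<close>, as the
  blocking lemmas require; the other side follows by swapping the parts.\<close>

lemma degree_three_reduction:
  assumes L: "laman22 G A B"
    and md: "min_degree G = 3"
    and vA: "v \<in> A"
    and deg: "degree G v = 3"
  shows "\<exists>x y p. x \<noteq> y \<and> adjacent G v x \<and> adjacent G v y \<and>
           p \<in> verts G \<and> adjacent G p y \<and> \<not> adjacent G p x \<and>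
           laman22 (add_edge (delete_vertex G v) x p) (A - {v}) (B - {v})"
proof (rule ccontr)
  assume neg: "\<not> ?thesis"
  have sg: "simple_graph G" and V: "verts G = A \<union> B" and dAB: "A \<inter> B = {}"
    and bip: "\<And>e. e \<in> edges G \<Longrightarrow> \<exists>a\<in>A. \<exists>b\<in>B. e = {a, b}"
    and cB: "2 \<le> card B" and cE: "card (edges G) = 2 * (card A + card B) - 4"
    using L by (auto simp: laman22_def bipartite_graph_def)
  have finV: "finite (A \<union> B)" using sg V by (simp add: simple_graph_def)
  have finE: "finite (edges G)"
    by (rule finite_subset[of _ "Pow (A \<union> B)"]) (use sg V finV in \<open>auto simp: simple_graph_def\<close>)
  define E where "E = {e \<in> edges G. v \<notin> e}"
  have vB: "v \<notin> B" using vA dAB by auto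
  interpret sparse_bipartite "A - {v}" B E
  proof
    show "finite (A - {v} \<union> B)" using finV by auto
    show "(A - {v}) \<inter> B = {}" using dAB by auto
    show "\<exists>a\<in>A - {v}. \<exists>b\<in>B. e = {a, b}" if "e \<in> E" for e
      using that bip[of e] by (auto simp: E_def)
    show "int (card {e \<in> E. e \<subseteq> W}) \<le> 2 * int (card W) - 4"
      if "W \<subseteq> A - {v} \<union> B" "3 \<le> card W" for W
    proof -
      have "{e \<in> E. e \<subseteq> W} = {e \<in> edges G. e \<subseteq> W}" using that vB by (auto simp: E_def)
      then show ?thesis using laman22_induced[OF L, of W] that V by auto
    qed
  qed
  have nbrB: "w \<in> B" if "adjacent G v w" for w
    using bip[of "{v, w}"] that vB by (auto simp: adjacent_def doubleton_eq_iff)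
  have adj_G: "adj x p \<longleftrightarrow> adjacent G x p \<and> p \<noteq> v" if "x \<noteq> v" for x p
    using that unfolding adj_def by (auto simp: adjacent_def E_def)
  define N where "N = {w \<in> verts G. adjacent G v w}"
  have N3: "card N = 3" using deg by (simp add: N_def degree_def)
  have NB: "N \<subseteq> B" using nbrB by (auto simp: N_def)
  obtain x y z where xyz: "N = {x, y, z}" "x \<noteq> y" "x \<noteq> z" "y \<noteq> z"
    using N3 by (auto simp: card_3_iff)
  have xN: "adjacent G v x" "adjacent G v y" "adjacent G v z" using xyz by (auto simp: N_def)
  have xB: "x \<in> B" "y \<in> B" "z \<in> B" using NB xyz by auto
  \<comment> \<open>Minimum degree three serves twice: it gives three vertices in \<open>A\<close>,
    so two remain without \<open>v\<close>, and it leaves \<open>x\<close> two neighbors after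
    \<open>v\<close> is deleted.\<close>
  have degx: "3 \<le> card {w \<in> verts G. adjacent G x w}"
  proof -
    have "min_degree G \<le> degree G x"
      unfolding min_degree_def using finV V xB by (intro Min_le) auto
    then show ?thesis using md by (simp add: degree_def)
  qed
  have cA3: "3 \<le> card A"
  proof -
    have "w \<in> A" if "adjacent G x w" for w
      using bip[of "{x, w}"] that xB(1) dAB by (auto simp: adjacent_def doubleton_eq_iff)
    then have "{w \<in> verts G. adjacent G x w} \<subseteq> A" by blast
    then show ?thesis using degx card_mono finV by (meson finite_Un order_trans)
  qed
  have cardE: "card E + 3 = card (edges G)"
  proof -
    have "edges G = E \<union> (\<lambda>w. {v, w}) ` N"
    proof (intro set_eqI iffI)
      fix e assume e: "e \<in> edges G"
      then obtain a b where ab: "a \<in> A" "b \<in> B" "e = {a, b}" using bip by blast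
      show "e \<in> E \<union> (\<lambda>w. {v, w}) ` N"
        using e ab vB V by (auto simp: E_def N_def adjacent_def)
    qed (auto simp: E_def N_def adjacent_def)
    moreover have "E \<inter> (\<lambda>w. {v, w}) ` N = {}" by (auto simp: E_def)
    moreover have "card ((\<lambda>w. {v, w}) ` N) = 3"
      using N3 by (subst card_image) (auto simp: inj_on_def doubleton_eq_iff)
    moreover have "finite E" "finite N" using finE finV V by (auto simp: E_def N_def)
    ultimately show ?thesis by (simp add: card_Un_disjoint)
  qed
  \<comment> \<open>If some \<open>p\<close> escaped every tight set through \<open>x\<close>,
    adding \<open>xp\<close> would give a Laman graph, against \<open>neg\<close>.\<close>
  have block: "blocked x y" if xy: "x \<noteq> y" "adjacent G v x" "adjacent G v y" for x y
  proof (rule ccontr)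
    assume "\<not> blocked x y"
    then obtain p where p: "adj y p" "\<not> adj x p" "\<And>T. tight T \<Longrightarrow> x \<in> T \<Longrightarrow> p \<notin> T"
      by (auto simp: blocked_def)
    have xyB: "x \<in> B" "y \<in> B" using xy nbrB by auto
    have nv: "x \<noteq> v" "y \<noteq> v" using xyB vB by auto
    have pA: "p \<in> A" "p \<noteq> v" using adj_A[OF xyB(2) p(1)] by auto
    have padj: "adjacent G p y" "\<not> adjacent G p x"
      using p adj_G nv pA by (auto simp: adjacent_def insert_commute)
    let ?G = "add_edge (delete_vertex G v) x p"
    have vG: "verts ?G = A - {v} \<union> (B - {v})" using V vB by (auto simp: add_edge_def delete_vertex_def)
    have eG: "edges ?G = insert {x, p} E" by (simp add: add_edge_def delete_vertex_def E_def)
    have px: "p \<noteq> x" using pA xyB dAB by auto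
    have bv: "B - {v} = B" using vB by auto
    have bG: "\<exists>a\<in>A - {v}. \<exists>b\<in>B - {v}. e = {a, b}" if "e \<in> edges ?G" for e
      using that edge[of e] pA xyB bv by (auto simp: eG insert_commute)
    have "simple_graph ?G"
      unfolding simple_graph_def
    proof (intro conjI ballI)
      show "finite (verts ?G)" using finV vG by auto
      fix e assume "e \<in> edges ?G"
      then obtain a b where ab: "a \<in> A - {v}" "b \<in> B - {v}" "e = {a, b}" using bG by blast
      then have "a \<noteq> b" using dAB by auto
      then show "e \<subseteq> verts ?G" "card e = 2" using vG ab by auto
    qed
    then have bip': "bipartite_graph ?G (A - {v}) (B - {v})"
      using vG bG dAB by (auto simp: bipartite_graph_def)
    have "{x, p} \<notin> E" using p by (simp add: adj_def)
    moreover have "finite E" using finE by (simp add: E_def)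
    ultimately have "card (edges ?G) = Suc (card E)" using eG by simp
    moreover have cAv: "card (A - {v}) = card A - 1" using vA finV by auto
    \<comment> \<open>Three edges are lost and one is gained, a net loss of 2 for one
      vertex.\<close>
    ultimately have cG: "card (edges ?G) = 2 * (card (A - {v}) + card (B - {v})) - 4"
      using cardE cE bv cA3 cB by simp
    have sub: "card (edges H) \<le> 2 * card (verts H) - 4"
      if H: "subgraph H ?G" "3 \<le> card (verts H)" for H
    proof -
      let ?W = "verts H"
      have W: "?W \<subseteq> A - {v} \<union> B" using H vG bv by (auto simp: subgraph_def)
      have eH: "edges H \<subseteq> {e \<in> insert {x, p} E. e \<subseteq> ?W}"
        using H eG by (auto simp: subgraph_def simple_graph_def)
      have fW: "finite {e \<in> E. e \<subseteq> ?W}" using finite_edges W by blast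
      have "int (card (edges H)) \<le> 2 * int (card ?W) - 4"
      proof (cases "{x, p} \<subseteq> ?W")
        case True
        \<comment> \<open>Only vertex sets containing both \<open>x\<close> and \<open>p\<close>
          gain an edge, and not being tight leaves room for exactly that one.\<close>
        then have "\<not> tight ?W" using p(3) by blast
        then have "0 \<le> defect ?W" "defect ?W \<noteq> 0"
          using W H defect_nonneg[OF W] by (auto simp: tight_def)
        then have "1 \<le> defect ?W" by linarith
        moreover have "edges H \<subseteq> insert {x, p} {e \<in> E. e \<subseteq> ?W}" using eH by auto
        then have "card (edges H) \<le> card (insert {x, p} {e \<in> E. e \<subseteq> ?W})"
          using fW by (intro card_mono) auto
        then have "card (edges H) \<le> Suc (card {e \<in> E. e \<subseteq> ?W})"
          using card_insert_le_m1 fW by (metis (lifting) card_insert_if le_SucI order_trans le_refl)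
        ultimately show ?thesis by (simp add: defect_def)
      next
        case False
        then have "edges H \<subseteq> {e \<in> E. e \<subseteq> ?W}" using eH by auto
        then have "card (edges H) \<le> card {e \<in> E. e \<subseteq> ?W}" using fW by (intro card_mono) auto
        then show ?thesis using sparse[OF W H(2)] by linarith
      qed
      then show ?thesis using H by linarith
    qed
    have "laman22 ?G (A - {v}) (B - {v})"
      unfolding laman22_def using bip' cAv bv cA3 cB cG sub by simp
    then show False using neg xy padj pA V by blast
  qed
  obtain p q where pq: "adj x p" "adj x q" "p \<noteq> q"
  proof -
    let ?M = "{w \<in> verts G. adjacent G x w} - {v}"
    have "2 \<le> card ?M" 
      using degx diff_card_le_card_Diff[of "{v}" "{w \<in> verts G. adjacent G x w}"] by simp
    then obtain M where "M \<subseteq> ?M" "card M = 2" by (rule obtain_subset_with_card_n)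
    then obtain p q where "p \<in> ?M" "q \<in> ?M" "p \<noteq> q" by (auto simp: card_2_iff)
    moreover have "x \<noteq> v" using xB vB by auto
    ultimately show ?thesis using that adj_G by auto
  qed
  obtain T where T: "tight T" "x \<in> T" "y \<in> T" "z \<in> T"
    using blocked_tight_triple[of x y z p q] block xN xyz xB pq by metis
  have TV: "T \<subseteq> A - {v} \<union> B" and T3: "3 \<le> card T" using T by (auto simp: tight_def)
  have fT: "finite T" using finite_sub TV by blast
  have vT: "v \<notin> T" using TV vB by auto
  \<comment> \<open>Adding \<open>v\<close> to \<open>T\<close> brings three edges where sparsity
    allows only two more, the final contradiction.\<close>
  have "{e \<in> E. e \<subseteq> T} \<union> (\<lambda>w. {v, w}) ` N \<subseteq> {e \<in> edges G. e \<subseteq> insert v T}"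
    using T xyz by (auto simp: E_def N_def adjacent_def)
  then have "card ({e \<in> E. e \<subseteq> T} \<union> (\<lambda>w. {v, w}) ` N) \<le> card {e \<in> edges G. e \<subseteq> insert v T}"
    using finE by (intro card_mono) auto
  moreover have "card ({e \<in> E. e \<subseteq> T} \<union> (\<lambda>w. {v, w}) ` N) = card {e \<in> E. e \<subseteq> T} + 3"
  proof -
    have "card ((\<lambda>w. {v, w}) ` N) = 3"
      using N3 by (subst card_image) (auto simp: inj_on_def doubleton_eq_iff)
    moreover have "finite N" using N3 card.infinite by fastforce
    moreover have "{e \<in> E. e \<subseteq> T} \<inter> (\<lambda>w. {v, w}) ` N = {}" by (auto simp: E_def)
    ultimately show ?thesis using finite_edges[OF TV] by (simp add: card_Un_disjoint)
  qed
  moreover have "int (card {e \<in> edges G. e \<subseteq> insert v T}) \<le> 2 * int (card (insert v T)) - 4"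
    using laman22_induced[OF L, of "insert v T"] TV V vA fT vT T3 by auto
  moreover have "defect T = 0" using T by (simp add: tight_def)
  ultimately show False using fT vT by (simp add: defect_def)
qed

theorem theorem3p1:
  fixes G :: "'a ugraph" and A B :: "'a set" and v :: 'a
  assumes "laman22 G A B"
    and "min_degree G = 3"
    and "v \<in> verts G"
    and "degree G v = 3"
  shows "\<exists>x y p. x \<noteq> y \<and> adjacent G v x \<and> adjacent G v y \<and>
           p \<in> verts G \<and> adjacent G p y \<and> \<not> adjacent G p x \<and>
           laman22 (add_edge (delete_vertex G v) x p) (A - {v}) (B - {v})"
proof (cases "v \<in> A")
  case True
  show ?thesis by (rule degree_three_reduction[OF assms(1,2) True assms(4)])
next
  case False
  then have "v \<in> B" using assms by (auto simp: laman22_def bipartite_graph_def)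
  then obtain x y p where xyp: "x \<noteq> y" "adjacent G v x" "adjacent G v y" "p \<in> verts G"
      "adjacent G p y" "\<not> adjacent G p x"
      "laman22 (add_edge (delete_vertex G v) x p) (B - {v}) (A - {v})"
    using degree_three_reduction[OF laman22_swap[OF assms(1)] assms(2) \<open>v \<in> B\<close> assms(4)]
    by (elim exE conjE)
  show ?thesis
    by (intro exI conjI) (rule xyp(1-6) laman22_swap[OF xyp(7)])+
qed

end
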